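(* Let $(X,d)$ be a finite metric space. The conservative complete linkage partition $r\mapsto P^*(r)$ defines a functor $P^*:(\mathbb{R}_+,\le)\to\mathbf{Part}(X)$, and $P^*$ is a persistent clique partition of $X$.
   Context: $\mathbb{R}_+=[0,\infty)$. A partition of $X$ is a family of nonempty pairwise disjoint subsets (blocks) with union $X$. $\mathbf{Part}(X)$ is the category whose objects are partitions of $X$ and whose morphisms $\{C_i\}_{i\in I}\to\{D_j\}_{j\in J}$ are refinement maps, i.e. functions $f:I\to J$ with $C_i\subseteq D_{f(i)}$ for all $i$. A persistent clique partition is a functor $P:(\mathbb{R}_+,\le)\to\mathbf{Part}(X)$ such that for every $r>0$ every block $C\in P(r)$ has $\mathrm{diam}(C)\le r$, and for $s\le t$ every block of $P(s)$ is contained in a block of $P(t)$. For disjoint nonempty subsets $A,B\subseteq X$ let $\ell(A,B)=\max_{x\in A,y\in B}d(x,y)$ (complete linkage). For a partition $Q$ of $X$ and $r\ge0$, the linkage graph $\Gamma_r(Q)$ has vertex set $Q$, with an edge between distinct blocks $B,B'\in Q$ if and only if $\ell(B,B')\le r$. Let $0<r_1<\dots<r_m$ be the distinct positive values of $d$, and $r_0=0$. The conservative complete linkage partition $P^*$ is defined inductively: $P^*(r)=\{\{x\}:x\in X\}$ for $r<r_1$. At each $r_i$, let $Q=P^*(r_{i-1})$; for each connected component $\mathcal{C}$ of $\Gamma_{r_i}(Q)$, if $\mathcal{C}$ is a clique in $\Gamma_{r_i}(Q)$ replace the blocks of $\mathcal{C}$ by the single block $\bigcup_{B\in\mathcal{C}}B$,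 and otherwise leave the blocks of $\mathcal{C}$ unchanged; the resulting partition is $P^*(r_i)$. Finally $P^*(r)=P^*(r_i)$ for $r\in[r_i,r_{i+1})$ (and for all $r\ge r_m$ when $i=m$). *)

theory Defs
  imports "HOL-Analysis.Analysis" "HOL-Library.Disjoint_Sets" "HOL-Library.FuncSet"
begin

section \<open>Categories and functors\<close>

text \<open>
  Objects form a carrier set, morphisms are given by hom-sets, and \<open>Comp C a b c g f\<close> is the
  composite of \<open>f\<close> from \<open>a\<close> to \<open>b\<close> followed by \<open>g\<close> from \<open>b\<close> to \<open>c\<close>.  Hom-sets
  of different pairs of objects may overlap, so composition carries its objects.
\<close>

record ('o, 'm) cat =
  Obj :: "'o set"
  Hom :: "'o \<Rightarrow> 'o \<Rightarrow> 'm set"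
  Id :: "'o \<Rightarrow> 'm"
  Comp :: "'o \<Rightarrow> 'o \<Rightarrow> 'o \<Rightarrow> 'm \<Rightarrow> 'm \<Rightarrow> 'm"

locale category =
  fixes C :: "('o, 'm) cat"
  assumes Id_in_Hom: "a \<in> Obj C \<Longrightarrow> Id C a \<in> Hom C a a"
    and Comp_in_Hom: "\<lbrakk>a \<in> Obj C; b \<in> Obj C; c \<in> Obj C; f \<in> Hom C a b; g \<in> Hom C b c\<rbrakk>
      \<Longrightarrow> Comp C a b c g f \<in> Hom C a c"
    and Comp_Id_right: "\<lbrakk>a \<in> Obj C; b \<in> Obj C; f \<in> Hom C a b\<rbrakk>
      \<Longrightarrow> Comp C a a b f (Id C a) = f"
    and Comp_Id_left: "\<lbrakk>a \<in> Obj C; b \<in> Obj C; f \<in> Hom C a b\<rbrakk>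
      \<Longrightarrow> Comp C a b b (Id C b) f = f"
    and Comp_assoc: "\<lbrakk>a \<in> Obj C; b \<in> Obj C; c \<in> Obj C; e \<in> Obj C;
        f \<in> Hom C a b; g \<in> Hom C b c; h \<in> Hom C c e\<rbrakk>
      \<Longrightarrow> Comp C a b e (Comp C b c e h g) f = Comp C a c e h (Comp C a b c g f)"

locale cat_functor = src: category C + tgt: category D
  for C :: "('o, 'm) cat" and D :: "('p, 'n) cat" +
  fixes Fobj :: "'o \<Rightarrow> 'p" and Fmor :: "'o \<Rightarrow> 'o \<Rightarrow> 'm \<Rightarrow> 'n"
  assumes Fobj_in_Obj: "a \<in> Obj C \<Longrightarrow> Fobj a \<in> Obj D"
    and Fmor_in_Hom: "\<lbrakk>a \<in> Obj C; b \<in> Obj C; f \<in> Hom C a b\<rbrakk>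
      \<Longrightarrow> Fmor a b f \<in> Hom D (Fobj a) (Fobj b)"
    and Fmor_Id: "a \<in> Obj C \<Longrightarrow> Fmor a a (Id C a) = Id D (Fobj a)"
    and Fmor_Comp: "\<lbrakk>a \<in> Obj C; b \<in> Obj C; c \<in> Obj C; f \<in> Hom C a b; g \<in> Hom C b c\<rbrakk>
      \<Longrightarrow> Fmor a c (Comp C a b c g f)
        = Comp D (Fobj a) (Fobj b) (Fobj c) (Fmor b c g) (Fmor a b f)"

definition poset_cat :: "'a::order set \<Rightarrow> ('a, unit) cat" where
  "poset_cat A = \<lparr>Obj = A, Hom = (\<lambda>s t. if s \<le> t then {()} else {}),
     Id = (\<lambda>_. ()), Comp = (\<lambda>_ _ _ _ _. ())\<rparr>"

text \<open>
  Blocks of a partition are nonempty and disjoint, hence distinct, so a partition is the set of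
  its blocks and serves as its own index set.  Refinement maps are extensional
  (\<open>undefined\<close> off the source partition), so that equal maps are equal as HOL functions.
\<close>

definition Part_cat :: "'a set \<Rightarrow> ('a set set, 'a set \<Rightarrow> 'a set) cat" where
  "Part_cat X = \<lparr>Obj = {P. partition_on X P},
     Hom = (\<lambda>P Q. {f \<in> P \<rightarrow>\<^sub>E Q. \<forall>B\<in>P. B \<subseteq> f B}),
     Id = (\<lambda>P. \<lambda>B\<in>P. B),
     Comp = (\<lambda>P Q R g f. compose P g f)\<rparr>"


section \<open>Persistent clique partitions\<close>

text \<open>The diameter of the library, for a distance \<open>d\<close> that is not given by a type class.\<close>

definition diam :: "('a \<Rightarrow> 'a \<Rightarrow> real) \<Rightarrow> 'a set \<Rightarrow> real" where
  "diam d S = (if S = {} then 0 else SUP (x, y)\<in>S \<times> S. d x y)"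

definition persistent_clique_partition ::
  "'a set \<Rightarrow> ('a \<Rightarrow> 'a \<Rightarrow> real) \<Rightarrow> (real \<Rightarrow> 'a set set)
    \<Rightarrow> (real \<Rightarrow> real \<Rightarrow> unit \<Rightarrow> 'a set \<Rightarrow> 'a set) \<Rightarrow> bool" where
  "persistent_clique_partition X d P T \<longleftrightarrow>
     cat_functor (poset_cat {0..}) (Part_cat X) P T \<and>
     (\<forall>r>0. \<forall>B\<in>P r. diam d B \<le> r) \<and>
     (\<forall>s t. 0 \<le> s \<and> s \<le> t \<longrightarrow> (\<forall>B\<in>P s. \<exists>B'\<in>P t. B \<subseteq> B'))"


section \<open>Conservative complete linkage\<close>

definition linkage :: "('a \<Rightarrow> 'a \<Rightarrow> real) \<Rightarrow> 'a set \<Rightarrow> 'a set \<Rightarrow> real" where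
  "linkage d A B = Max ((\<lambda>(x, y). d x y) ` (A \<times> B))"

text \<open>The linkage graph on the vertex set \<open>Q\<close>, given by its (symmetric) edge relation.\<close>

definition linkage_edges :: "('a \<Rightarrow> 'a \<Rightarrow> real) \<Rightarrow> real \<Rightarrow> 'a set set \<Rightarrow> 'a set rel" where
  "linkage_edges d r Q = {(B, B'). B \<in> Q \<and> B' \<in> Q \<and> B \<noteq> B' \<and> linkage d B B' \<le> r}"

text \<open>For a symmetric edge relation \<open>E\<close> on \<open>V\<close>, connectedness by a path is \<open>E\<^sup>*\<close>.\<close>

definition connected_comps :: "'v set \<Rightarrow> 'v rel \<Rightarrow> 'v set set" where
  "connected_comps V E = V // E\<^sup>*"

definition is_clique :: "'v rel \<Rightarrow> 'v set \<Rightarrow> bool" where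
  "is_clique E K \<longleftrightarrow> (\<forall>u\<in>K. \<forall>v\<in>K. u \<noteq> v \<longrightarrow> (u, v) \<in> E)"

definition merge_cliques :: "('a \<Rightarrow> 'a \<Rightarrow> real) \<Rightarrow> real \<Rightarrow> 'a set set \<Rightarrow> 'a set set" where
  "merge_cliques d r Q =
     (\<Union>K\<in>connected_comps Q (linkage_edges d r Q).
        if is_clique (linkage_edges d r Q) K then {\<Union>K} else K)"

definition pos_dists :: "'a set \<Rightarrow> ('a \<Rightarrow> 'a \<Rightarrow> real) \<Rightarrow> real set" where
  "pos_dists X d = {d x y |x y. x \<in> X \<and> y \<in> X \<and> 0 < d x y}"

text \<open>The thresholds \<open>0 = r\<^sub>0 < r\<^sub>1 < \<dots> < r\<^sub>m\<close>, where \<open>m = card (pos_dists X d)\<close>.\<close>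

definition threshold :: "'a set \<Rightarrow> ('a \<Rightarrow> 'a \<Rightarrow> real) \<Rightarrow> nat \<Rightarrow> real" where
  "threshold X d i = (0 # sorted_list_of_set (pos_dists X d)) ! i"

primrec cclp_step :: "'a set \<Rightarrow> ('a \<Rightarrow> 'a \<Rightarrow> real) \<Rightarrow> nat \<Rightarrow> 'a set set" where
  "cclp_step X d 0 = {{x} |x. x \<in> X}"
| "cclp_step X d (Suc i) = merge_cliques d (threshold X d (Suc i)) (cclp_step X d i)"

text \<open>
  Meaningful for \<open>r \<ge> 0\<close> only: the greatest \<open>i \<le> m\<close> with \<open>r\<^sub>i \<le> r\<close> is the one with
  \<open>r\<^sub>i \<le> r < r\<^sub>i\<^sub>+\<^sub>1\<close>, or \<open>m\<close> if \<open>r\<^sub>m \<le> r\<close>.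
\<close>

definition cclp :: "'a set \<Rightarrow> ('a \<Rightarrow> 'a \<Rightarrow> real) \<Rightarrow> real \<Rightarrow> 'a set set" where
  "cclp X d r =
     cclp_step X d (GREATEST i. i \<le> card (pos_dists X d) \<and> threshold X d i \<le> r)"

text \<open>
  The action on morphisms: a block goes to the block containing it.  As blocks are nonempty and
  disjoint, there is at most one refinement map between two partitions, so this is the only
  possible choice.
\<close>

definition cclp_map ::
  "'a set \<Rightarrow> ('a \<Rightarrow> 'a \<Rightarrow> real) \<Rightarrow> real \<Rightarrow> real \<Rightarrow> unit \<Rightarrow> 'a set \<Rightarrow> 'a set" where
  "cclp_map X d s t u = (\<lambda>B\<in>cclp X d s. THE B'. B' \<in> cclp X d t \<and> B \<subseteq> B')"

end

theory Submission
  imports Defs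
begin

text \<open>
  Only pairwise linked blocks are merged at \<open>r\<^sub>i\<close>, so by induction points of a common block
  of \<open>P\<^sup>*(r\<^sub>i)\<close> are at distance at most \<open>r\<^sub>i\<close>.  Merging whole components yields a partition
  coarser than the previous one, so \<open>P\<^sup>*\<close> is an increasing family of partitions, and functoriality
  is automatic because there is at most one refinement map between two partitions.
\<close>

section \<open>Partitions under refinement, and functors into them\<close>

lemma category_poset_cat: "category (poset_cat A)"
  by unfold_locales (auto simp: poset_cat_def split: if_splits)

lemma category_Part_cat: "category (Part_cat X)"
proof unfold_locales
  fix P Q R f g
  assume f: "f \<in> Hom (Part_cat X) P Q" and g: "g \<in> Hom (Part_cat X) Q R"
  have "B \<subseteq> g (f B)" if "B \<in> P" for B
  proof -
    have "f B \<in> Q" "B \<subseteq> f B"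
      using f that by (auto simp: Part_cat_def)
    then show ?thesis
      using g by (fastforce simp: Part_cat_def)
  qed
  with f g show "Comp (Part_cat X) P Q R g f \<in> Hom (Part_cat X) P R"
    by (auto simp: Part_cat_def compose_def)
qed (auto simp: Part_cat_def compose_def fun_eq_iff PiE_iff extensional_def)

text \<open>The block \<open>B\<close> is nonempty, so \<open>C\<close> and \<open>C'\<close> share
  a point, and distinct blocks of \<open>Q\<close> are disjoint.\<close>

lemma partition_on_superset_unique:
  assumes "partition_on X P" "partition_on X Q" "B \<in> P"
    and "C \<in> Q" "B \<subseteq> C" "C' \<in> Q" "B \<subseteq> C'"
  shows "C = C'"
proof -
  have "B \<noteq> {}" using assms by (auto simp: partition_on_def)
  then have "C \<inter> C' \<noteq> {}" using assms by blast
  then show ?thesis using assms by (meson partition_onD2 disjointD)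
qed

text \<open>On a block of \<open>P\<close> both maps have to take the only block of \<open>Q\<close>
  containing it; off \<open>P\<close> both are \<open>undefined\<close> by extensionality. An
  equation between refinement maps thus reduces to both sides lying in the same hom-set.\<close>

lemma Part_cat_hom_unique:
  assumes "partition_on X P" "partition_on X Q"
    and "f \<in> Hom (Part_cat X) P Q" "g \<in> Hom (Part_cat X) P Q"
  shows "f = g"
proof (rule PiE_ext)
  show "f \<in> P \<rightarrow>\<^sub>E Q" "g \<in> P \<rightarrow>\<^sub>E Q" using assms by (auto simp: Part_cat_def)
  fix B assume "B \<in> P"
  then show "f B = g B"
    using assms by (intro partition_on_superset_unique[of X P Q B]) (auto simp: Part_cat_def)
qed

lemma refines_imp_hom:
  assumes "refines X P Q"
  shows "(\<lambda>B\<in>P. THE B'. B' \<in> Q \<and> B \<subseteq> B') \<in> Hom (Part_cat X) P Q"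
proof -
  have "(THE B'. B' \<in> Q \<and> B \<subseteq> B') \<in> Q \<and> B \<subseteq> (THE B'. B' \<in> Q \<and> B \<subseteq> B')" if "B \<in> P" for B
  proof (rule theI')
    have PQ: "partition_on X P" "partition_on X Q" and "\<exists>C\<in>Q. B \<subseteq> C"
      using assms that by (auto simp: refines_def)
    then show "\<exists>!B'. B' \<in> Q \<and> B \<subseteq> B'"
      using partition_on_superset_unique[OF PQ that] by blast
  qed
  then show ?thesis by (auto simp: Part_cat_def)
qed

text \<open>Each functor law equates two refinement maps between the same partitions, so uniqueness
  of such maps proves it without evaluating \<open>THE\<close>.\<close>

lemma cat_functor_Part_cat:
  assumes "\<And>s t. s \<in> A \<Longrightarrow> t \<in> A \<Longrightarrow> s \<le> t \<Longrightarrow> refines X (P s) (P t)"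
  shows "cat_functor (poset_cat A) (Part_cat X) P
    (\<lambda>s t u. \<lambda>B\<in>P s. THE B'. B' \<in> P t \<and> B \<subseteq> B')" (is "cat_functor _ _ _ ?T")
proof -
  interpret S: category "poset_cat A" by (rule category_poset_cat)
  interpret T: category "Part_cat X" by (rule category_Part_cat)
  have part: "partition_on X (P s)" if "s \<in> A" for s
    using assms[OF that that] by (simp add: refines_def)
  then have obj: "P s \<in> Obj (Part_cat X)" if "s \<in> A" for s
    using that by (simp add: Part_cat_def)
  have hom: "?T s t u \<in> Hom (Part_cat X) (P s) (P t)" if "s \<in> A" "t \<in> A" "s \<le> t" for s t u
    using refines_imp_hom assms that by blast
  show ?thesis
  proof unfold_locales
    fix a assume "a \<in> Obj (poset_cat A)"
    then have a: "a \<in> A" by (simp add: poset_cat_def)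
    show "P a \<in> Obj (Part_cat X)" by (rule obj[OF a])
    show "?T a a (Id (poset_cat A) a) = Id (Part_cat X) (P a)"
      by (rule Part_cat_hom_unique[OF part[OF a] part[OF a] hom[OF a a order_refl]
          T.Id_in_Hom[OF obj[OF a]]])
  next
    fix a b f
    assume "a \<in> Obj (poset_cat A)" "b \<in> Obj (poset_cat A)" "f \<in> Hom (poset_cat A) a b"
    then show "?T a b f \<in> Hom (Part_cat X) (P a) (P b)"
      by (intro hom) (auto simp: poset_cat_def split: if_splits)
  next
    fix a b c f g
    assume "a \<in> Obj (poset_cat A)" "b \<in> Obj (poset_cat A)" "c \<in> Obj (poset_cat A)"
      "f \<in> Hom (poset_cat A) a b" "g \<in> Hom (poset_cat A) b c"
    then have m: "a \<in> A" "b \<in> A" "c \<in> A" and le: "a \<le> b" "b \<le> c"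
      by (auto simp: poset_cat_def split: if_splits)
    show "?T a c (Comp (poset_cat A) a b c g f)
        = Comp (Part_cat X) (P a) (P b) (P c) (?T b c g) (?T a b f)"
      by (rule Part_cat_hom_unique[OF part[OF m(1)] part[OF m(3)]
            hom[OF m(1) m(3) order_trans[OF le]]
            T.Comp_in_Hom[OF obj[OF m(1)] obj[OF m(2)] obj[OF m(3)]
              hom[OF m(1) m(2) le(1)] hom[OF m(2) m(3) le(2)]]])
  qed
qed

section \<open>Bounds on diameter and linkage; coarsening a partition\<close>

lemma diam_le:
  assumes "S \<noteq> {}" "\<And>x y. x \<in> S \<Longrightarrow> y \<in> S \<Longrightarrow> d x y \<le> r"
  shows "diam d S \<le> r"
  \<comment> \<open>Nonemptiness rules out the default diameter 0, which a negative \<open>r\<close>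
    would not bound.\<close>
  using assms unfolding diam_def by (auto intro!: cSUP_least)

lemma le_linkage:
  assumes "finite A" "finite B" "x \<in> A" "y \<in> B"
  shows "d x y \<le> linkage d A B"
  unfolding linkage_def using assms by (intro Max_ge) auto

text \<open>The relation \<open>E\<^sup>*\<close> is reflexive on the whole type, so it is first cut
  down to \<open>V \<times> V\<close> to become an equivalence on \<open>V\<close>. The classes of
  vertices stay the same, because a path starting in \<open>V\<close> never leaves it.\<close>

lemma partition_on_connected_comps:
  assumes "E \<subseteq> V \<times> V" "sym E"
  shows "partition_on V (connected_comps V E)"
proof -
  have "E\<^sup>* `` {v} \<subseteq> V" if "v \<in> V" for v
  proof
    fix w assume "w \<in> E\<^sup>* `` {v}"
    then have "(v, w) \<in> E\<^sup>*" by simp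
    then show "w \<in> V" using that assms(1) by (cases rule: rtranclE) auto
  qed
  then have eq: "V // E\<^sup>* = V // (E\<^sup>* \<inter> V \<times> V)"
    unfolding quotient_def by (intro SUP_cong) auto
  have "equiv V (E\<^sup>* \<inter> V \<times> V)"
  proof (rule equivI)
    show "refl_on V (E\<^sup>* \<inter> V \<times> V)" by (auto simp: refl_on_def)
    show "sym (E\<^sup>* \<inter> V \<times> V)" using sym_rtrancl[OF assms(2)] by (auto simp: sym_def)
    show "trans (E\<^sup>* \<inter> V \<times> V)" using trans_rtrancl[of E] by (fastforce simp: trans_def)
  qed auto
  then show ?thesis
    unfolding connected_comps_def eq by (rule partition_on_quotient)
qed

text \<open>Which classes get merged is irrelevant, so \<open>c\<close> is arbitrary: merging
  preserves the union of a class, and the unions of different classes are disjoint.\<close>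

lemma partition_on_coarsen_some:
  assumes Q: "partition_on X Q" and C: "partition_on Q C"
  shows "partition_on X (\<Union>K\<in>C. if c K then {\<Union>K} else K)" (is "partition_on X ?R")
proof (rule partition_onI)
  have UQ: "\<Union>Q = X" and ne: "{} \<notin> Q" and disj: "\<And>A B. A \<in> Q \<Longrightarrow> B \<in> Q \<Longrightarrow> A \<noteq> B \<Longrightarrow> A \<inter> B = {}"
    using Q by (auto simp: partition_on_def disjoint_def)
  have UC: "\<Union>C = Q" and neC: "{} \<notin> C" and disjC: "\<And>K L. K \<in> C \<Longrightarrow> L \<in> C \<Longrightarrow> K \<noteq> L \<Longrightarrow> K \<inter> L = {}"
    using C by (auto simp: partition_on_def disjoint_def)
  have "\<Union>?R = \<Union>(\<Union>C)" by (auto split: if_splits)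
  then show "\<Union>?R = X" using UQ UC by simp
  show "{} \<notin> ?R"
  proof
    assume "{} \<in> ?R"
    then obtain K where K: "K \<in> C" "{} \<in> (if c K then {\<Union>K} else K)" by (rule UN_E)
    then have "K \<noteq> {}" "K \<subseteq> Q" using neC UC by auto
    then obtain A where "A \<in> K" "A \<noteq> {}" using ne by blast
    then show False using K \<open>K \<subseteq> Q\<close> ne by (auto split: if_splits)
  qed
  fix p q assume "p \<in> ?R" "q \<in> ?R" and pq: "p \<noteq> q"
  then obtain K L where K: "K \<in> C" "p \<in> (if c K then {\<Union>K} else K)"
    and L: "L \<in> C" "q \<in> (if c L then {\<Union>L} else L)" by (elim UN_E)
  have KQ: "K \<subseteq> Q" and LQ: "L \<subseteq> Q" using UC K L by auto
  show "disjnt p q"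
  proof (cases "K = L")
    case True
    \<comment> \<open>A merged class contributes only one block, so \<open>p \<noteq> q\<close>
      means that this class was left unchanged.\<close>
    then have "p \<in> Q" "q \<in> Q" using K L pq KQ by (auto split: if_splits)
    then show ?thesis using disj pq by (simp add: disjnt_def)
  next
    case False
    have "\<Union>K \<inter> \<Union>L = {}"
    proof (rule ccontr)
      assume "\<Union>K \<inter> \<Union>L \<noteq> {}"
      then obtain A B where "A \<in> K" "B \<in> L" "A \<inter> B \<noteq> {}" by blast
      moreover from this have "A = B" using disj KQ LQ by blast
      ultimately show False using disjC[OF K(1) L(1) False] by blast
    qed
    moreover have "p \<subseteq> \<Union>K" "q \<subseteq> \<Union>L" using K L by (auto split: if_splits)
    ultimately show ?thesis unfolding disjnt_def by blast
  qed
qed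

section \<open>One merging step in a finite metric space\<close>

locale finite_metric_space = Metric_space M d for M :: "'a set" and d +
  assumes finite_carrier: "finite M"
begin

lemma sym_linkage_edges: "sym (linkage_edges d r Q)"
proof -
  have "(\<lambda>(x, y). d x y) ` (A \<times> B) = (\<lambda>(x, y). d x y) ` (B \<times> A)" for A B
    by (force simp: commute image_iff)
  then have "linkage d A B = linkage d B A" for A B
    by (simp add: linkage_def)
  then show ?thesis by (auto simp: linkage_edges_def sym_def)
qed

lemma partition_on_linkage_comps:
  "partition_on Q (connected_comps Q (linkage_edges d r Q))"
  by (rule partition_on_connected_comps[OF _ sym_linkage_edges]) (auto simp: linkage_edges_def)

lemma refines_merge_cliques:
  assumes "partition_on M Q"
  shows "refines M Q (merge_cliques d r Q)"
proof -
  let ?E = "linkage_edges d r Q"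
  have "\<exists>B'\<in>merge_cliques d r Q. B \<subseteq> B'" if B: "B \<in> Q" for B
  proof -
    have "\<Union>(connected_comps Q ?E) = Q"
      using partition_on_linkage_comps[of Q r] by (simp add: partition_on_def)
    then obtain K where K: "K \<in> connected_comps Q ?E" "B \<in> K"
      using B by blast
    \<comment> \<open>The successor of \<open>B\<close>: the union of its component if that is
      merged, \<open>B\<close> itself otherwise.\<close>
    let ?B' = "if is_clique ?E K then \<Union>K else B"
    have "?B' \<in> (if is_clique ?E K then {\<Union>K} else K)" "B \<subseteq> ?B'"
      using K by auto
    with K show ?thesis unfolding merge_cliques_def by blast
  qed
  moreover have "partition_on M (merge_cliques d r Q)"
    unfolding merge_cliques_def
    by (rule partition_on_coarsen_some[OF assms partition_on_linkage_comps])
  ultimately show ?thesis using assms by (auto simp: refines_def)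
qed

text \<open>Two points of a merged block lie either in one old block, where the assumed bound
  applies, or in two old blocks that are adjacent because the component is a clique; complete
  linkage then bounds every distance between them.\<close>

lemma merge_cliques_dist_le:
  assumes Q: "partition_on M Q"
    and le: "\<And>B x y. B \<in> Q \<Longrightarrow> x \<in> B \<Longrightarrow> y \<in> B \<Longrightarrow> d x y \<le> r"
    and "B \<in> merge_cliques d r Q" "x \<in> B" "y \<in> B"
  shows "d x y \<le> r"
proof -
  let ?E = "linkage_edges d r Q"
  obtain K where K: "K \<in> connected_comps Q ?E" and B: "B \<in> (if is_clique ?E K then {\<Union>K} else K)"
    using assms(3) unfolding merge_cliques_def by (rule UN_E)
  have KQ: "K \<subseteq> Q" using partition_onD1[OF partition_on_linkage_comps] K by blast
  show ?thesis
  proof (cases "is_clique ?E K")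
    case True
    then obtain A A' where A: "A \<in> K" "x \<in> A" "A' \<in> K" "y \<in> A'"
      using B assms by auto
    show ?thesis
    proof (cases "A = A'")
      case True
      then show ?thesis using le A KQ by blast
    next
      case False
      with True A have "linkage d A A' \<le> r"
        by (auto simp: is_clique_def linkage_edges_def)
      \<comment> \<open>Blocks must be finite for \<open>linkage\<close>, a \<open>Max\<close>, to
        be an upper bound.\<close>
      moreover have "A \<subseteq> M" "A' \<subseteq> M"
        using A KQ partition_onD1[OF Q] by auto
      then have "finite A" "finite A'"
        using finite_carrier finite_subset by blast+
      ultimately show ?thesis using le_linkage[of A A' x y d] A by linarith
    qed
  next
    case False
    then show ?thesis using B KQ le assms by auto
  qed
qed

section \<open>The thresholds and the inductive sequence of partitions\<close>

lemma finite_pos_dists: "finite (pos_dists M d)"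
proof -
  have "pos_dists M d \<subseteq> (\<lambda>(x, y). d x y) ` (M \<times> M)" by (auto simp: pos_dists_def)
  then show ?thesis using finite_carrier by (auto intro: finite_subset)
qed

lemma threshold_mono:
  assumes "i \<le> j" "j \<le> card (pos_dists M d)"
  shows "threshold M d i \<le> threshold M d j"
proof -
  \<comment> \<open>Prepending 0 keeps the list sorted, as all its other entries are positive. The
    list has \<open>card (pos_dists M d) + 1\<close> entries, so the bound on \<open>j\<close> keeps
    both indices in range.\<close>
  have "sorted (0 # sorted_list_of_set (pos_dists M d))"
    using finite_pos_dists by (auto simp: pos_dists_def)
  then show ?thesis
    unfolding threshold_def using assms by (intro sorted_nth_mono) auto
qed

text \<open>No bound on \<open>i\<close> appears: merging yields a partition at every radius,
  including the unspecified thresholds past the end of the list.\<close>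

lemma partition_on_cclp_step: "partition_on M (cclp_step M d i)"
proof (induction i)
  case 0
  show ?case by (auto simp: partition_on_def disjoint_def)
next
  case (Suc i)
  then show ?case using refines_merge_cliques by (auto simp: refines_def)
qed

lemma refines_cclp_step:
  assumes "i \<le> j"
  shows "refines M (cclp_step M d i) (cclp_step M d j)"
  using assms
proof (induction rule: dec_induct)
  case base
  show ?case using partition_on_cclp_step by (auto simp: refines_def)
next
  case (step j)
  then show ?case
    using refines_merge_cliques[OF partition_on_cclp_step] by (auto intro: refines_trans)
qed

lemma cclp_step_dist_le:
  assumes "i \<le> card (pos_dists M d)" "B \<in> cclp_step M d i" "x \<in> B" "y \<in> B"
  shows "d x y \<le> threshold M d i"
  using assms
proof (induction i arbitrary: B x y)
  case 0
  then show ?case by (auto simp: threshold_def)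
next
  case (Suc i)
  \<comment> \<open>Old blocks obey the previous threshold; monotonicity lifts this to the radius of
    the new merge.\<close>
  have "d u v \<le> threshold M d (Suc i)" if "A \<in> cclp_step M d i" "u \<in> A" "v \<in> A" for A u v
    using Suc.IH[OF _ that] Suc.prems(1) threshold_mono[of i "Suc i"] by linarith
  then show ?case
    using merge_cliques_dist_le[OF partition_on_cclp_step _ Suc.prems(2)[simplified] Suc.prems(3,4)]
    by blast
qed

section \<open>From indices to real parameters\<close>

definition level :: "real \<Rightarrow> nat" where
  "level r = (GREATEST i. i \<le> card (pos_dists M d) \<and> threshold M d i \<le> r)"

lemma cclp_eq_step: "cclp M d r = cclp_step M d (level r)"
  by (simp add: cclp_def level_def)

text \<open>The greatest index exists: 0 qualifies since \<open>threshold M d 0\<close> is 0, and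
  all candidates are bounded by the number of positive distances.\<close>

lemma level_props:
  assumes "0 \<le> r"
  shows "level r \<le> card (pos_dists M d)" "threshold M d (level r) \<le> r"
proof -
  have "level r \<le> card (pos_dists M d) \<and> threshold M d (level r) \<le> r"
    unfolding level_def
    by (rule GreatestI_nat[where k = 0 and b = "card (pos_dists M d)"])
      (use assms in \<open>auto simp: threshold_def\<close>)
  then show "level r \<le> card (pos_dists M d)" "threshold M d (level r) \<le> r" by auto
qed

lemma level_mono:
  assumes "0 \<le> s" "s \<le> t"
  shows "level s \<le> level t"
  unfolding level_def[of t]
  \<comment> \<open>The index \<open>level s\<close> is itself a candidate for
    \<open>level t\<close>, since its threshold is at most \<open>s\<close>, hence at most
    \<open>t\<close>.\<close>
  by (rule Greatest_le_nat[where b = "card (pos_dists M d)"]) (use level_props[of s] assms in auto)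

lemma refines_cclp:
  assumes "0 \<le> s" "s \<le> t"
  shows "refines M (cclp M d s) (cclp M d t)"
  unfolding cclp_eq_step by (rule refines_cclp_step[OF level_mono[OF assms]])

text \<open>Distances within a block are at most the threshold of the current level, which is at
  most \<open>r\<close>.\<close>

lemma diam_cclp_le:
  assumes "0 \<le> r" "B \<in> cclp M d r"
  shows "diam d B \<le> r"
proof (rule diam_le)
  have B: "B \<in> cclp_step M d (level r)" using assms by (simp add: cclp_eq_step)
  then show "B \<noteq> {}" using partition_on_cclp_step[of "level r"] by (auto simp: partition_on_def)
  show "d x y \<le> r" if "x \<in> B" "y \<in> B" for x y
    using cclp_step_dist_le[OF level_props(1)[OF assms(1)] B that] level_props(2)[OF assms(1)]
    by linarith
qed

lemma cat_functor_cclp: "cat_functor (poset_cat {0..}) (Part_cat M) (cclp M d) (cclp_map M d)"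
proof -
  have "cclp_map M d = (\<lambda>s t u. \<lambda>B\<in>cclp M d s. THE B'. B' \<in> cclp M d t \<and> B \<subseteq> B')"
    by (intro ext) (simp add: cclp_map_def)
  moreover have "cat_functor (poset_cat {0..}) (Part_cat M) (cclp M d)
      (\<lambda>s t u. \<lambda>B\<in>cclp M d s. THE B'. B' \<in> cclp M d t \<and> B \<subseteq> B')"
    by (rule cat_functor_Part_cat) (simp add: refines_cclp)
  ultimately show ?thesis by simp
qed

lemma persistent_clique_partition_cclp:
  "persistent_clique_partition M d (cclp M d) (cclp_map M d)"
  unfolding persistent_clique_partition_def
proof (intro conjI allI impI ballI)
  show "diam d B \<le> r" if "0 < r" "B \<in> cclp M d r" for r B
    using that by (simp add: diam_cclp_le)
  show "\<exists>B'\<in>cclp M d t. B \<subseteq> B'" if "0 \<le> s \<and> s \<le> t" "B \<in> cclp M d s" for s t B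
    using refines_cclp[of s t] that by (auto simp: refines_def)
qed (rule cat_functor_cclp)

end

theorem proposition5p9:
  fixes X :: "'a set" and d :: "'a \<Rightarrow> 'a \<Rightarrow> real"
  assumes "Metric_space X d" and "finite X"
  shows "cat_functor (poset_cat {0..}) (Part_cat X) (cclp X d) (cclp_map X d) \<and>
         persistent_clique_partition X d (cclp X d) (cclp_map X d)"
proof -
  interpret finite_metric_space X d
    using assms by (simp add: finite_metric_space_def finite_metric_space_axioms_def)
  show ?thesis
    using cat_functor_cclp persistent_clique_partition_cclp by simp
qed

end
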